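(* Let $R$ be an Artinian commutative ring with unity such that the total zero-divisor graph $\mathrm{ZT}(R)$ is connected and not empty. Then: (1) If $R$ is not local, then $\mathrm{diam}(\mathrm{ZT}(R))=3$. (2) If $R$ is local and $\mathfrak{m}$ is its unique maximal ideal, with nilindex $n\geq 3$, then $\mathrm{diam}(\mathrm{ZT}(R))=2$. (3) If $R$ is local and $\mathfrak{m}$ is its unique maximal ideal, such that $\mathfrak{m}^2=0$ and $\mathfrak{m}\neq\{0\}$, then $\mathrm{diam}(\mathrm{ZT}(R))=1$.
   Context: For a commutative ring $R$ with unity, $Z(R)$ denotes the set of zero-divisors of $R$, with $0\in Z(R)$. The total zero-divisor graph $\mathrm{ZT}(R)$ is the simple graph whose vertex set is the set of all nonzero zero-divisors of $R$ and in which distinct vertices $u,v$ are adjacent if and only if $uv=0$ and $u+v\in Z(R)$. A graph is called empty if it has no edges. The nilindex of a nilpotent ideal $I$ is the smallest positive integer $\ell$ such that the product of any $\ell$ elements of $I$ is $0$. The distance between two vertices is the length of a shortest path between them, and $\mathrm{diam}(G)$ is the largest distance between any two vertices of $G$. *)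

theory Defs
  imports
    Graph_Theory.Shortest_Path
    Graph_Theory.Digraph_Component
    "HOL-Algebra.Ideal_Product"
begin

section \<open>Rings\<close>

locale artinian_cring = cring +
  assumes descending_chain:
    "\<lbrakk> \<And>n::nat. ideal (I n) R; antimono I \<rbrakk> \<Longrightarrow> \<exists>n. \<forall>m\<ge>n. I m = I n"

locale local_cring = cring +
  assumes ex1_maximalideal: "\<exists>!M. maximalideal M R"

text \<open>Zero counts as a zero-divisor by convention, also in the zero ring.\<close>

definition zero_divisors :: "('a, 'b) ring_scheme \<Rightarrow> 'a set"
  where "zero_divisors R =
    insert \<zero>\<^bsub>R\<^esub> {x \<in> carrier R. \<exists>y \<in> carrier R. y \<noteq> \<zero>\<^bsub>R\<^esub> \<and> x \<otimes>\<^bsub>R\<^esub> y = \<zero>\<^bsub>R\<^esub>}"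

definition products_vanish :: "('a, 'b) ring_scheme \<Rightarrow> 'a set \<Rightarrow> nat \<Rightarrow> bool"
  where "products_vanish R I l \<longleftrightarrow>
    (\<forall>x \<in> {..<l} \<rightarrow> I. finprod R x {..<l} = \<zero>\<^bsub>R\<^esub>)"

text \<open>A relation rather than a function, since only nilpotent ideals have a nilindex.\<close>

definition has_nilindex :: "('a, 'b) ring_scheme \<Rightarrow> 'a set \<Rightarrow> nat \<Rightarrow> bool"
  where "has_nilindex R I n \<longleftrightarrow>
    0 < n \<and> products_vanish R I n \<and> (\<forall>l. 0 < l \<and> l < n \<longrightarrow> \<not> products_vanish R I l)"

section \<open>Graphs\<close>

text \<open>
  As in the library, an undirected graph is a symmetric digraph. It may be infinite, so
  the locale \<^locale>\<open>graph\<close>, which requires finiteness, does not apply.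
\<close>

text \<open>With all weights 1, the cost of a walk is its number of edges, and the infimum over
  all walks is the length of a shortest path (infinite if there is none).\<close>

definition distance :: "('a, 'b) pre_digraph \<Rightarrow> 'a \<Rightarrow> 'a \<Rightarrow> ereal"
  where "distance G u v = wf_digraph.\<mu> G (\<lambda>_. 1) u v"

text \<open>A finite supremum over a nonempty vertex set is attained, since the distances lie in
  the natural numbers extended by infinity.\<close>

definition diameter :: "('a, 'b) pre_digraph \<Rightarrow> ereal"
  where "diameter G = (SUP (u, v) \<in> verts G \<times> verts G. distance G u v)"

definition total_zero_divisor_graph :: "('a, 'b) ring_scheme \<Rightarrow> ('a, 'a \<times> 'a) pre_digraph"
    (\<open>ZT\<close>)
  where "ZT R = with_proj
    \<lparr> pverts = zero_divisors R - {\<zero>\<^bsub>R\<^esub>},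
      parcs = {(u, v). u \<in> zero_divisors R - {\<zero>\<^bsub>R\<^esub>} \<and> v \<in> zero_divisors R - {\<zero>\<^bsub>R\<^esub>} \<and>
        u \<noteq> v \<and> u \<otimes>\<^bsub>R\<^esub> v = \<zero>\<^bsub>R\<^esub> \<and> u \<oplus>\<^bsub>R\<^esub> v \<in> zero_divisors R} \<rparr>"

lemma (in cring) ZT_loopfree: "loopfree_digraph (ZT R)"
  by unfold_locales (auto simp: total_zero_divisor_graph_def)

lemma (in cring) ZT_nomulti: "nomulti_digraph (ZT R)"
  by unfold_locales (auto simp: total_zero_divisor_graph_def arc_to_ends_def)

lemma (in cring) ZT_symmetric: "sym_digraph (ZT R)"
proof -
  have "zero_divisors R \<subseteq> carrier R"
    by (auto simp: zero_divisors_def)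
  then show ?thesis
    by unfold_locales
      (auto simp: total_zero_divisor_graph_def symmetric_def m_comm a_comm subset_iff
        intro!: symI)
qed

end

theory Submission
  imports Defs
begin

text \<open>
  Call an element \<open>x\<close> minimal if the ideal \<open>R x\<close> is a minimal nonzero ideal. Everything rests on
  such elements. By the descending chain condition every zero-divisor \<open>u\<close> is annihilated by a
  minimal element, because \<open>Ann u\<close> contains a minimal ideal; and the annihilator of a minimal element
  is a maximal ideal, because \<open>R x \<cong> R / Ann x\<close> is simple.

  If the graph is connected and has an edge, then every minimal element has square zero:
  otherwise \<open>R x\<close> is generated by an idempotent \<open>e\<close> and is a field, which is a direct factor of
  \<open>R\<close> and not all of \<open>R\<close>, as a field has no nonzero zero-divisors; then \<open>1 - e\<close> is an isolated vertex, since its neighbours lie in that field and their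
  sums with \<open>1 - e\<close> are units. Two distinct minimal elements \<open>x\<close> and \<open>x'\<close> with square zero are
  adjacent, and such an \<open>x\<close> is adjacent to every other vertex that it annihilates. So any two
  vertices \<open>u\<close> and \<open>v\<close> are joined by a walk \<open>u, x, x', v\<close>, possibly with repetitions, and the
  diameter is at most 3.

  If \<open>R\<close> is not local, then it has a nontrivial idempotent \<open>e\<close>. The vertices \<open>e\<close> and \<open>1 - e\<close> are not
  adjacent, since their sum is \<open>1\<close>, and they have no common neighbour, since that would be
  annihilated by \<open>1\<close>. Their distance is therefore 3.

  If \<open>R\<close> is local with maximal ideal \<open>M\<close>, then every minimal \<open>x\<close> has \<open>Ann x = M\<close>, so that \<open>M\<close> is the
  set of zero-divisors and \<open>x\<close> is adjacent to all other vertices; the diameter is at most 2.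
  As \<open>M\<close> is closed under sums, adjacency just means that the product vanishes. So the graph is
  complete if \<open>M\<^sup>2 = 0\<close>. If \<open>a b \<noteq> 0\<close> for some \<open>a\<close> and \<open>b\<close> in \<open>M\<close>, then it is not complete:
  take \<open>a\<close> and \<open>b\<close> when they differ, and \<open>a\<close> and \<open>a + x\<close> when they coincide.
\<close>

section \<open>Distance and diameter\<close>

text \<open>
  The powers of the adjacency relation replace walks from here on: a relational power determines
  the number of steps, and composing relations avoids naming the arcs.
\<close>

lemma (in wf_digraph) awalk_imp_relpow:
  "awalk u p v \<Longrightarrow> (u, v) \<in> arcs_ends G ^^ length p"
proof (induction p arbitrary: u)
  case Nil
  then show ?case by (simp add: awalk_Nil_iff)
next
  case (Cons e p)
  then have "(u, head G e) \<in> arcs_ends G" "(head G e, v) \<in> arcs_ends G ^^ length p"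
    by (auto simp: awalk_Cons_iff arcs_ends_conv)
  then show ?case
    unfolding length_Cons by (rule relpow_Suc_I2)
qed

lemma (in wf_digraph) relpow_imp_awalk:
  "(u, v) \<in> arcs_ends G ^^ k \<Longrightarrow> v \<in> verts G \<Longrightarrow> \<exists>p. awalk u p v \<and> length p = k"
proof (induction k arbitrary: u)
  case 0
  then show ?case by (auto simp: awalk_Nil_iff)
next
  case (Suc k)
  then obtain w where "(u, w) \<in> arcs_ends G" and w: "(w, v) \<in> arcs_ends G ^^ k"
    by (blast dest: relpow_Suc_D2)
  then obtain e where e: "e \<in> arcs G" "u = tail G e" "w = head G e"
    by (auto simp: arcs_ends_conv)
  obtain p where "awalk w p v" "length p = k"
    using Suc.IH[OF w Suc.prems(2)] by blast
  with e show ?case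
    by (intro exI[of _ "e # p"]) (auto simp: awalk_Cons_iff)
qed

lemma (in wf_digraph) awalk_cost_unit: "awalk_cost (\<lambda>_. 1) p = real (length p)"
  unfolding awalk_cost_def by (simp add: sum_list_triv)

lemma (in wf_digraph) distance_le:
  assumes "(u, v) \<in> arcs_ends G ^^ k" "v \<in> verts G"
  shows "distance G u v \<le> real k"
proof -
  obtain p where p: "awalk u p v" "length p = k"
    using relpow_imp_awalk[OF assms] by blast
  show ?thesis
    using min_cost_le_walk_cost[OF p(1), of "\<lambda>_. 1"] p(2)
    unfolding distance_def awalk_cost_unit by simp
qed

lemma (in wf_digraph) le_distance:
  assumes "\<And>k. k < n \<Longrightarrow> (u, v) \<notin> arcs_ends G ^^ k"
  shows "real n \<le> distance G u v"
  unfolding distance_def \<mu>_def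
proof (rule INF_greatest)
  fix p assume "p \<in> {p. awalk u p v}"
  then have "(u, v) \<in> arcs_ends G ^^ length p"
    by (simp add: awalk_imp_relpow)
  then have "n \<le> length p"
    using assms[of "length p"] by (meson not_le)
  then show "ereal (real n) \<le> ereal (awalk_cost (\<lambda>_. 1) p)"
    unfolding awalk_cost_unit by simp
qed

lemma diameter_eqI:
  assumes "\<And>u v. u \<in> verts G \<Longrightarrow> v \<in> verts G \<Longrightarrow> distance G u v \<le> d"
    and "a \<in> verts G" "b \<in> verts G" "d \<le> distance G a b"
  shows "diameter G = d"
  unfolding diameter_def
proof (rule antisym)
  show "(SUP (u, v) \<in> verts G \<times> verts G. distance G u v) \<le> d"
    by (rule SUP_least) (clarsimp simp only: mem_Sigma_iff split: prod.split, rule assms(1))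
  show "d \<le> (SUP (u, v) \<in> verts G \<times> verts G. distance G u v)"
    by (rule SUP_upper2[of "(a, b)"]) (simp_all only: assms(2-4) mem_Sigma_iff prod.case)
qed

lemma (in wf_digraph) connected_imp_ex_neighbour:
  assumes "symmetric G" "connected G" "a \<in> verts G" "b \<in> verts G" "a \<noteq> b"
  obtains w where "a \<rightarrow>\<^bsub>G\<^esub> w"
proof -
  have "a \<rightarrow>\<^sup>*\<^bsub>G\<^esub> b"
    using symmetric_connected_imp_strongly_connected[OF assms(1,2)] assms(3,4)
    by (auto simp: strongly_connected_def)
  then show thesis
    using assms(5) that by (cases rule: converse_reachable_cases) auto
qed

section \<open>Minimal elements\<close>

lemma (in ring) minus_eq_zero_iff:
  assumes "x \<in> carrier R" "y \<in> carrier R"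
  shows "x \<ominus> y = \<zero> \<longleftrightarrow> x = y"
proof
  assume "x \<ominus> y = \<zero>"
  moreover have "x = (x \<ominus> y) \<oplus> y"
    using assms by algebra
  ultimately show "x = y"
    using assms by simp
qed (use assms in \<open>simp add: minus_eq r_neg\<close>)

context cring
begin

text \<open>
  The condition says that \<open>R x\<close> is a minimal nonzero ideal: each of its nonzero elements \<open>a x\<close>
  generates \<open>x\<close> again.
\<close>

definition minimal_elem :: "'a \<Rightarrow> bool"
  where "minimal_elem x \<longleftrightarrow> x \<in> carrier R \<and> x \<noteq> \<zero> \<and>
    (\<forall>a \<in> carrier R. a \<otimes> x \<noteq> \<zero> \<longrightarrow> (\<exists>r \<in> carrier R. x = r \<otimes> (a \<otimes> x)))"

definition annihilator :: "'a \<Rightarrow> 'a set"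
  where "annihilator x = {a \<in> carrier R. a \<otimes> x = \<zero>}"

lemma minimal_elemD:
  assumes "minimal_elem x"
  shows "x \<in> carrier R" "x \<noteq> \<zero>"
  using assms by (auto simp: minimal_elem_def)

lemma minimal_elem_recover:
  assumes "minimal_elem x" "a \<in> carrier R" "a \<otimes> x \<noteq> \<zero>"
  obtains r where "r \<in> carrier R" "x = r \<otimes> (a \<otimes> x)"
  using assms by (auto simp: minimal_elem_def)

lemma annihilator_ideal:
  assumes "x \<in> carrier R"
  shows "ideal (annihilator x) R"
proof (rule idealI)
  show "ring R" by (rule ring_axioms)
  show "subgroup (annihilator x) (add_monoid R)"
    using assms
    by unfold_locales (auto simp: annihilator_def l_distr l_minus simp flip: a_inv_def)
  fix a y assume "a \<in> annihilator x" "y \<in> carrier R"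
  then show "y \<otimes> a \<in> annihilator x" "a \<otimes> y \<in> annihilator x"
    using assms by (auto simp: annihilator_def m_assoc m_lcomm[of a y x])
qed

text \<open>
  If \<open>b x \<noteq> 0\<close>, then \<open>x = r b x\<close> for some \<open>r\<close>, so \<open>1 - r b\<close> annihilates \<open>x\<close>. An ideal that contains
  \<open>Ann x\<close> and \<open>b\<close> therefore contains \<open>1\<close>.
\<close>

lemma annihilator_maximalideal:
  assumes x: "minimal_elem x"
  shows "maximalideal (annihilator x) R"
proof (rule maximalidealI)
  note xc = minimal_elemD[OF x]
  show "ideal (annihilator x) R"
    using xc by (simp add: annihilator_ideal)
  show "carrier R \<noteq> annihilator x"
  proof
    assume "carrier R = annihilator x"
    then have "\<one> \<in> annihilator x"
      using one_closed by (rule subst)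
    then show False
      using xc by (simp add: annihilator_def)
  qed
  fix J assume J: "ideal J R" "annihilator x \<subseteq> J" "J \<subseteq> carrier R"
  show "J = annihilator x \<or> J = carrier R"
  proof (rule disjCI)
    assume "J \<noteq> carrier R"
    have "b \<otimes> x = \<zero>" if b: "b \<in> J" for b
    proof (rule ccontr)
      assume "b \<otimes> x \<noteq> \<zero>"
      have bc: "b \<in> carrier R" using b J by auto
      obtain r where r: "r \<in> carrier R" "x = r \<otimes> (b \<otimes> x)"
        using minimal_elem_recover[OF x bc \<open>b \<otimes> x \<noteq> \<zero>\<close>] .
      have "(\<one> \<ominus> r \<otimes> b) \<otimes> x = x \<ominus> r \<otimes> (b \<otimes> x)"
        using bc r(1) xc by algebra
      also have "\<dots> = \<zero>"
        using r xc by (simp add: minus_eq_zero_iff flip: r(2))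
      finally have "\<one> \<ominus> r \<otimes> b \<in> J"
        using J(2) bc r(1) by (auto simp: annihilator_def)
      moreover have "r \<otimes> b \<in> J"
        using ideal.I_l_closed[OF J(1) b r(1)] .
      ultimately have "(\<one> \<ominus> r \<otimes> b) \<oplus> r \<otimes> b \<in> J"
        by (rule additive_subgroup.a_closed[OF ideal.axioms(1)[OF J(1)]])
      moreover have "(\<one> \<ominus> r \<otimes> b) \<oplus> r \<otimes> b = \<one>"
        using bc r(1) by algebra
      ultimately show False
        using ideal.one_imp_carrier[OF J(1)] \<open>J \<noteq> carrier R\<close> by simp
    qed
    then show "J = annihilator x"
      using J by (auto simp: annihilator_def)
  qed
qed

text \<open>
  If the product were nonzero, then \<open>y\<close> would be a multiple of \<open>x y\<close>, and hence \<open>x y\<close> a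
  multiple of \<open>x\<^sup>2\<close>.
\<close>

lemma minimal_elem_mult_eq_zero:
  assumes x: "minimal_elem x" "x \<otimes> x = \<zero>" and y: "minimal_elem y"
  shows "x \<otimes> y = \<zero>"
proof (rule ccontr)
  assume "x \<otimes> y \<noteq> \<zero>"
  note c = minimal_elemD(1)[OF x(1)] minimal_elemD(1)[OF y]
  obtain r where r: "r \<in> carrier R" "y = r \<otimes> (x \<otimes> y)"
    using minimal_elem_recover[OF y c(1) \<open>x \<otimes> y \<noteq> \<zero>\<close>] .
  have "x \<otimes> y = x \<otimes> (r \<otimes> (x \<otimes> y))"
    using r(2) by simp
  also have "\<dots> = r \<otimes> y \<otimes> (x \<otimes> x)"
    using c r(1) by (simp add: m_ac)
  finally show False
    using x(2) c r(1) \<open>x \<otimes> y \<noteq> \<zero>\<close> by simp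
qed

end

text \<open>
  The chain condition is used only for principal ideals, in this form: the set \<open>S\<close> of admissible
  generators may be arbitrary.
\<close>

lemma (in artinian_cring) ex_minimal_principal_ideal:
  assumes "S \<subseteq> carrier R" "S \<noteq> {}"
  obtains s where "s \<in> S" "\<And>t. t \<in> S \<Longrightarrow> t \<in> PIdl s \<Longrightarrow> s \<in> PIdl t"
proof -
  have "\<exists>s\<in>S. \<forall>t\<in>S. t \<in> PIdl s \<longrightarrow> s \<in> PIdl t"
  proof (rule ccontr)
    assume "\<not> ?thesis"
    then have "\<forall>s\<in>S. \<exists>t\<in>S. t \<in> PIdl s \<and> s \<notin> PIdl t"
      by blast
    then have "\<exists>f. \<forall>n::nat. f n \<in> S \<and> (f (Suc n) \<in> PIdl (f n) \<and> f n \<notin> PIdl (f (Suc n)))"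
      using assms(2) by (intro dependent_nat_choice) auto
    then obtain f where f: "\<And>n::nat. f n \<in> S" "\<And>n. f (Suc n) \<in> PIdl (f n)"
        "\<And>n. f n \<notin> PIdl (f (Suc n))"
      by blast
    have fc: "f n \<in> carrier R" for n
      using f(1) assms(1) by blast
    have ideals: "ideal (PIdl (f n)) R" for n
      using fc cgenideal_ideal by blast
    have "antimono (\<lambda>n. PIdl (f n))"
      using f(2) ideals by (intro decseq_SucI cgenideal_minimal) auto
    then obtain n where n: "\<forall>m\<ge>n. PIdl (f m) = PIdl (f n)"
      using descending_chain[of "\<lambda>n. PIdl (f n)"] ideals by blast
    have "PIdl (f (Suc n)) = PIdl (f n)"
      using n[rule_format, OF le_SucI[OF order_refl]] .
    then show False
      using f(3) cgenideal_self[OF fc] by blast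
  qed
  then show thesis
    using that by blast
qed

text \<open>
  Among the nonzero elements of the annihilator of \<open>u\<close>, one that generates a minimal principal
  ideal is minimal in \<open>R\<close>, because this annihilator is closed under multiples.
\<close>

lemma (in artinian_cring) ex_minimal_elem_annihilated:
  assumes "u \<in> carrier R" "y \<in> carrier R" "y \<noteq> \<zero>" "u \<otimes> y = \<zero>"
  obtains x where "minimal_elem x" "u \<otimes> x = \<zero>"
proof -
  define S where "S = {x \<in> carrier R. x \<noteq> \<zero> \<and> u \<otimes> x = \<zero>}"
  have "S \<subseteq> carrier R" "S \<noteq> {}"
    using assms by (auto simp: S_def)
  then obtain x where x: "x \<in> S" "\<And>t. t \<in> S \<Longrightarrow> t \<in> PIdl x \<Longrightarrow> x \<in> PIdl t"
    by (rule ex_minimal_principal_ideal) blast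
  have "\<exists>r \<in> carrier R. x = r \<otimes> (a \<otimes> x)" if a: "a \<in> carrier R" "a \<otimes> x \<noteq> \<zero>" for a
  proof -
    have "a \<otimes> x \<in> S"
      using a x(1) assms(1) by (auto simp: S_def m_lcomm[of u a x])
    moreover have "a \<otimes> x \<in> PIdl x"
      using a by (auto simp: cgenideal_def)
    ultimately have "x \<in> PIdl (a \<otimes> x)"
      by (rule x(2))
    then show ?thesis
      by (auto simp: cgenideal_def)
  qed
  with x(1) have "minimal_elem x" "u \<otimes> x = \<zero>"
    by (auto simp: minimal_elem_def S_def)
  then show thesis by (rule that)
qed

text \<open>
  Two distinct maximal ideals \<open>M\<close> and \<open>N\<close> yield the idempotent. The set \<open>M - N\<close> is
  multiplicatively closed, and if \<open>s\<close> in it generates an ideal that is minimal among those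
  generated by its elements, then \<open>s\<close> is a multiple \<open>s\<^sup>2 y\<close> of its square. So \<open>s y\<close> is idempotent; it
  lies in \<open>M\<close> but not in \<open>N\<close>.
\<close>

lemma (in artinian_cring) ex_nontrivial_idempotent:
  assumes "\<not> local_cring R" "\<one> \<noteq> \<zero>"
  obtains e where "e \<in> carrier R" "e \<otimes> e = e" "e \<noteq> \<zero>" "e \<noteq> \<one>"
proof -
  \<comment> \<open>A minimal element provides a maximal ideal, and \<open>R\<close> not being local then provides a second.\<close>
  obtain x where "minimal_elem x"
    using ex_minimal_elem_annihilated[of \<zero> \<one>] assms(2) by auto
  then have "\<exists>M. maximalideal M R"
    using annihilator_maximalideal by blast
  moreover have "\<nexists>!M. maximalideal M R"
    using assms(1) cring_axioms by (auto simp: local_cring_def local_cring_axioms_def)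
  ultimately obtain M N where MN: "maximalideal M R" "maximalideal N R" "M \<noteq> N"
    by blast
  interpret M: maximalideal M R by (rule MN(1))
  interpret N: maximalideal N R by (rule MN(2))
  interpret N': primeideal N R by (rule maximalideal_prime[OF MN(2)])
  have "\<not> M \<subseteq> N"
    using M.I_maximal[OF N.ideal_axioms] MN(3) N.I_notcarr N.a_subset by auto
  then have "M - N \<subseteq> carrier R" "M - N \<noteq> {}"
    using M.a_subset by auto
  then obtain s where s: "s \<in> M - N" "\<And>t. t \<in> M - N \<Longrightarrow> t \<in> PIdl s \<Longrightarrow> s \<in> PIdl t"
    by (rule ex_minimal_principal_ideal) blast
  have sc: "s \<in> carrier R"
    using s(1) M.a_subset by auto
  have "s \<otimes> s \<in> M - N"
    using s(1) sc M.I_l_closed N'.I_prime by blast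
  moreover have "s \<otimes> s \<in> PIdl s"
    using sc by (auto simp: cgenideal_def)
  ultimately have "s \<in> PIdl (s \<otimes> s)"
    by (rule s(2))
  then obtain y where y: "y \<in> carrier R" "s = y \<otimes> (s \<otimes> s)"
    by (auto simp: cgenideal_def)
  define e where "e = y \<otimes> s"
  have es: "e \<otimes> s = s"
    using y sc by (simp add: e_def m_assoc)
  have ec: "e \<in> carrier R"
    using y sc by (simp add: e_def)
  have "e \<otimes> e = y \<otimes> (e \<otimes> s)"
    using y(1) sc ec by (simp add: e_def m_ac)
  then have "e \<otimes> e = e"
    using es by (simp add: e_def)
  moreover have "e \<in> M"
    using s(1) y(1) M.I_l_closed by (simp add: e_def)
  then have "e \<noteq> \<one>"
    using M.one_imp_carrier M.I_notcarr by auto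
  moreover have "e \<notin> N"
  proof
    assume "e \<in> N"
    then have "e \<otimes> s \<in> N"
      using sc N.I_r_closed by blast
    then show False
      using es s(1) by simp
  qed
  then have "e \<noteq> \<zero>"
    using N.zero_closed by auto
  ultimately show thesis
    using ec by (intro that)
qed

section \<open>Adjacency in the total zero-divisor graph\<close>

lemma verts_ZT [simp]: "verts (ZT R) = zero_divisors R - {\<zero>\<^bsub>R\<^esub>}"
  by (simp add: total_zero_divisor_graph_def)

lemma ZT_adjacent_iff:
  "u \<rightarrow>\<^bsub>ZT R\<^esub> v \<longleftrightarrow> u \<in> zero_divisors R - {\<zero>\<^bsub>R\<^esub>} \<and> v \<in> zero_divisors R - {\<zero>\<^bsub>R\<^esub>} \<and>
    u \<noteq> v \<and> u \<otimes>\<^bsub>R\<^esub> v = \<zero>\<^bsub>R\<^esub> \<and> u \<oplus>\<^bsub>R\<^esub> v \<in> zero_divisors R"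
  by (simp add: total_zero_divisor_graph_def)

lemma (in cring) zero_divisors_subset: "zero_divisors R \<subseteq> carrier R"
  by (auto simp: zero_divisors_def)

lemma (in cring) zero_divisorI:
  "u \<in> carrier R \<Longrightarrow> y \<in> carrier R \<Longrightarrow> y \<noteq> \<zero> \<Longrightarrow> u \<otimes> y = \<zero> \<Longrightarrow> u \<in> zero_divisors R"
  by (auto simp: zero_divisors_def)

lemma (in cring) zero_divisorE:
  assumes "u \<in> zero_divisors R" "\<one> \<noteq> \<zero>"
  obtains y where "y \<in> carrier R" "y \<noteq> \<zero>" "u \<otimes> y = \<zero>"
  using assms that[of \<one>] by (auto simp: zero_divisors_def)

lemma (in cring) one_not_zero_divisor: "\<one> \<noteq> \<zero> \<Longrightarrow> \<one> \<notin> zero_divisors R"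
  by (auto simp: zero_divisors_def)

text \<open>The square-zero element \<open>x\<close> annihilates \<open>u + x\<close>, so this sum is a zero-divisor.\<close>

lemma (in cring) ZT_adjacent_square_zero:
  assumes "u \<in> carrier R" "u \<noteq> \<zero>" "x \<in> carrier R" "x \<noteq> \<zero>" "x \<otimes> x = \<zero>" "u \<otimes> x = \<zero>" "u \<noteq> x"
  shows "u \<rightarrow>\<^bsub>ZT R\<^esub> x"
  using assms by (auto simp: ZT_adjacent_iff l_distr intro!: zero_divisorI[of _ x])

lemma (in cring) ZT_adjacent_sym: "u \<rightarrow>\<^bsub>ZT R\<^esub> v \<Longrightarrow> v \<rightarrow>\<^bsub>ZT R\<^esub> u"
  using zero_divisors_subset by (auto simp: ZT_adjacent_iff m_comm a_comm subset_iff)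

text \<open>
  Here \<open>e = r x\<close> is idempotent. A neighbour \<open>w\<close> of \<open>1 - e\<close> lies in \<open>R e = R x\<close>. So does every \<open>y\<close> that annihilates
  \<open>(1 - e) + w\<close>, since it annihilates \<open>1 - e = (1 - e) ((1 - e) + w)\<close>. But then \<open>w y = 0\<close>, whereas \<open>R x\<close> is
  a field with unit element \<open>e\<close>.
\<close>

lemma (in cring) complement_of_field_factor_isolated:
  assumes "\<one> \<noteq> \<zero>" and x: "minimal_elem x" and r: "r \<in> carrier R" "x = r \<otimes> (x \<otimes> x)"
  shows "\<not> (\<one> \<ominus> r \<otimes> x) \<rightarrow>\<^bsub>ZT R\<^esub> w"
proof
  define a where "a = \<one> \<ominus> r \<otimes> x"
  note xc = minimal_elemD[OF x]
  have ac: "a \<in> carrier R"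
    using r xc by (simp add: a_def)
  assume "(\<one> \<ominus> r \<otimes> x) \<rightarrow>\<^bsub>ZT R\<^esub> w"
  then have w: "w \<in> zero_divisors R" "w \<noteq> \<zero>" "a \<otimes> w = \<zero>" "a \<oplus> w \<in> zero_divisors R"
    by (auto simp: ZT_adjacent_iff a_def)
  have wc: "w \<in> carrier R"
    using w(1) zero_divisors_subset by auto
  obtain y where y: "y \<in> carrier R" "y \<noteq> \<zero>" "(a \<oplus> w) \<otimes> y = \<zero>"
    using w(4) assms(1) by (rule zero_divisorE)
  have in_Rx: "z = r \<otimes> (x \<otimes> z)" if "z \<in> carrier R" "a \<otimes> z = \<zero>" for z
  proof -
    have "z = a \<otimes> z \<oplus> r \<otimes> (x \<otimes> z)"
      using that(1) r(1) xc(1) unfolding a_def by algebra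
    then show ?thesis
      using that r(1) xc(1) by simp
  qed
  have "a \<otimes> x = x \<ominus> r \<otimes> (x \<otimes> x)"
    using r(1) xc(1) unfolding a_def by algebra
  then have ax: "a \<otimes> x = \<zero>"
    using xc(1) by (simp add: minus_eq_zero_iff flip: r(2))
  have "a \<otimes> a = a \<ominus> r \<otimes> (a \<otimes> x)"
    using r(1) xc(1) unfolding a_def by algebra
  then have aa: "a \<otimes> a = a"
    using ax ac r(1) by (simp add: a_minus_def)
  have "a \<otimes> y = (a \<otimes> a) \<otimes> y \<oplus> (a \<otimes> w) \<otimes> y"
    using aa w(3) ac y(1) by simp
  also have "\<dots> = a \<otimes> ((a \<oplus> w) \<otimes> y)"
    using ac wc y(1) by algebra
  finally have ay: "a \<otimes> y = \<zero>"
    using y(3) ac by simp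
  then have wy: "w \<otimes> y = \<zero>"
    using y ac wc by (simp add: l_distr)
  have "w \<otimes> x \<noteq> \<zero>"
    using in_Rx[OF wc w(3)] w(2) r(1) xc(1) wc by (auto simp: m_comm[of x w])
  then obtain q where q: "q \<in> carrier R" "x = q \<otimes> (w \<otimes> x)"
    by (rule minimal_elem_recover[OF x wc])
  have "x \<otimes> y = q \<otimes> (w \<otimes> x) \<otimes> y"
    using q(2) by simp
  also have "\<dots> = q \<otimes> x \<otimes> (w \<otimes> y)"
    using q(1) wc xc(1) y(1) by (simp add: m_ac)
  finally have "x \<otimes> y = \<zero>"
    using wy q(1) xc(1) by simp
  then show False
    using in_Rx[OF y(1) ay] y(2) r(1) by simp
qed

section \<open>Connected total zero-divisor graphs\<close>

locale connected_ZT = artinian_cring +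
  assumes connected: "Digraph_Component.connected (ZT R)"
    and nonempty: "arcs (ZT R) \<noteq> {}"
begin

sublocale ZT: sym_digraph "ZT R"
  by (rule ZT_symmetric)

lemma ex_edge:
  obtains b c where "b \<rightarrow>\<^bsub>ZT R\<^esub> c"
  using nonempty by (auto simp: arcs_ends_conv)

lemma one_neq_zero: "\<one> \<noteq> \<zero>"
proof
  assume "\<one> = \<zero>"
  then have "carrier R = {\<zero>}"
    by (simp add: carrier_one_zero)
  moreover obtain b c where "b \<rightarrow>\<^bsub>ZT R\<^esub> c"
    by (rule ex_edge)
  ultimately show False
    using zero_divisors_subset by (auto simp: ZT_adjacent_iff)
qed

lemma not_isolated:
  assumes "a \<in> zero_divisors R" "a \<noteq> \<zero>"
  obtains w where "a \<rightarrow>\<^bsub>ZT R\<^esub> w"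
proof -
  obtain b c where bc: "b \<rightarrow>\<^bsub>ZT R\<^esub> c"
    by (rule ex_edge)
  define d where "d = (if a = b then c else b)"
  have "d \<in> verts (ZT R)" "a \<noteq> d"
    using bc by (auto simp: d_def ZT_adjacent_iff)
  then show thesis
    using ZT.connected_imp_ex_neighbour[OF ZT.sym_arcs connected, of a d] assms that by auto
qed

text \<open>
  If \<open>x\<^sup>2 \<noteq> 0\<close>, then \<open>x = r x\<^sup>2\<close>, and \<open>1 - r x\<close> has no neighbour. In a connected graph with an edge
  it can then not be a vertex, and it is a zero-divisor, so it is \<open>0\<close> and \<open>R\<close> is a field.
\<close>

lemma minimal_elem_square_zero:
  assumes x: "minimal_elem x"
  shows "x \<otimes> x = \<zero>"
proof (rule ccontr)
  assume "x \<otimes> x \<noteq> \<zero>"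
  note xc = minimal_elemD[OF x]
  obtain r where r: "r \<in> carrier R" "x = r \<otimes> (x \<otimes> x)"
    using minimal_elem_recover[OF x xc(1) \<open>x \<otimes> x \<noteq> \<zero>\<close>] .
  define a where "a = \<one> \<ominus> r \<otimes> x"
  have ac: "a \<in> carrier R"
    using r(1) xc by (simp add: a_def)
  have isolated: "\<not> a \<rightarrow>\<^bsub>ZT R\<^esub> w" for w
    unfolding a_def by (rule complement_of_field_factor_isolated[OF one_neq_zero x r])
  have "a \<otimes> x = x \<ominus> r \<otimes> (x \<otimes> x)"
    using r(1) xc(1) unfolding a_def by algebra
  then have "a \<otimes> x = \<zero>"
    using xc(1) by (simp add: minus_eq_zero_iff flip: r(2))
  then have "a \<in> zero_divisors R"
    using ac xc by (intro zero_divisorI)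
  then have "a = \<zero>"
    using not_isolated isolated by blast
  \<comment> \<open>Now \<open>x\<close> is a unit, so \<open>R = R x\<close> is a field and there is no edge.\<close>
  then have rx: "r \<otimes> x = \<one>"
    using r(1) xc(1) minus_eq_zero_iff[of \<one> "r \<otimes> x"] by (simp add: a_def)
  obtain b c where "b \<rightarrow>\<^bsub>ZT R\<^esub> c"
    by (rule ex_edge)
  then have b: "b \<in> carrier R" "b \<noteq> \<zero>" "c \<in> carrier R" "c \<noteq> \<zero>" "b \<otimes> c = \<zero>"
    using zero_divisors_subset by (auto simp: ZT_adjacent_iff)
  have "r \<otimes> (b \<otimes> x) = b"
    using rx r(1) b xc(1) by (simp add: m_lcomm[of r b x])
  then have "b \<otimes> x \<noteq> \<zero>"
    using b r(1) by auto
  then obtain q where q: "q \<in> carrier R" "x = q \<otimes> (b \<otimes> x)"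
    by (rule minimal_elem_recover[OF x b(1)])
  have "c = r \<otimes> x \<otimes> c"
    using rx b by simp
  also have "\<dots> = r \<otimes> (q \<otimes> (b \<otimes> x)) \<otimes> c"
    using q(2) by simp
  also have "\<dots> = r \<otimes> q \<otimes> x \<otimes> (b \<otimes> c)"
    using r(1) q(1) b(1,3) xc(1) by (simp add: m_ac)
  finally show False
    using b r(1) q(1) xc(1) by simp
qed

lemma ex_minimal_neighbour:
  assumes "u \<in> zero_divisors R" "u \<noteq> \<zero>"
  obtains x where "minimal_elem x" "u = x \<or> u \<rightarrow>\<^bsub>ZT R\<^esub> x"
proof -
  have uc: "u \<in> carrier R"
    using assms zero_divisors_subset by auto
  obtain y where "y \<in> carrier R" "y \<noteq> \<zero>" "u \<otimes> y = \<zero>"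
    using assms(1) one_neq_zero by (rule zero_divisorE)
  then obtain x where x: "minimal_elem x" "u \<otimes> x = \<zero>"
    using ex_minimal_elem_annihilated uc by blast
  then have "u = x \<or> u \<rightarrow>\<^bsub>ZT R\<^esub> x"
    using ZT_adjacent_square_zero[OF uc assms(2)] minimal_elemD minimal_elem_square_zero by blast
  with x(1) show thesis by (rule that)
qed

lemma minimal_elems_adjacent:
  assumes "minimal_elem x" "minimal_elem y" "x \<noteq> y"
  shows "x \<rightarrow>\<^bsub>ZT R\<^esub> y"
  using minimal_elemD[OF assms(1)] minimal_elemD[OF assms(2)] minimal_elem_square_zero[OF assms(2)]
    minimal_elem_mult_eq_zero[OF assms(1) minimal_elem_square_zero[OF assms(1)] assms(2)] assms(3)
  by (intro ZT_adjacent_square_zero)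

text \<open>The walk \<open>u, w, z, v\<close> may repeat vertices, because the minimal elements that are found for
  two vertices may coincide with each other or with these vertices.\<close>

lemma distance_le_of_steps:
  assumes "u = w \<or> u \<rightarrow>\<^bsub>ZT R\<^esub> w" "w = z \<or> w \<rightarrow>\<^bsub>ZT R\<^esub> z" "z = v \<or> z \<rightarrow>\<^bsub>ZT R\<^esub> v" "v \<in> verts (ZT R)"
  shows "distance (ZT R) u v \<le> 3"
proof -
  let ?E = "arcs_ends (ZT R)"
  have "\<exists>k\<le>3. (u, v) \<in> ?E ^^ k"
  proof -
    have *: "(p, q) \<in> ?E ^^ 0 \<or> (p, q) \<in> ?E ^^ 1" if "p = q \<or> p \<rightarrow>\<^bsub>ZT R\<^esub> q" for p q
      using that by auto
    have "\<exists>i\<le>1. (u, w) \<in> ?E ^^ i" "\<exists>i\<le>1. (w, z) \<in> ?E ^^ i" "\<exists>i\<le>1. (z, v) \<in> ?E ^^ i"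
      using *[OF assms(1)] *[OF assms(2)] *[OF assms(3)] by (meson order_refl zero_le)+
    then obtain i j l where "i \<le> 1" "(u, w) \<in> ?E ^^ i" "j \<le> 1" "(w, z) \<in> ?E ^^ j"
        "l \<le> 1" "(z, v) \<in> ?E ^^ l"
      by blast
    then have "(u, v) \<in> ?E ^^ (i + j + l)" "i + j + l \<le> 3"
      by (auto simp: relpow_add)
    then show ?thesis by blast
  qed
  then obtain k where k: "k \<le> 3" "(u, v) \<in> ?E ^^ k" by blast
  have "distance (ZT R) u v \<le> ereal (real k)"
    using k(2) assms(4) by (rule ZT.distance_le)
  also have "\<dots> \<le> 3"
    using k(1) by simp
  finally show ?thesis .
qed

lemma distance_le_3:
  assumes "u \<in> verts (ZT R)" "v \<in> verts (ZT R)"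
  shows "distance (ZT R) u v \<le> 3"
proof -
  obtain x where x: "minimal_elem x" "u = x \<or> u \<rightarrow>\<^bsub>ZT R\<^esub> x"
    using ex_minimal_neighbour assms(1) by auto
  obtain y where y: "minimal_elem y" "v = y \<or> v \<rightarrow>\<^bsub>ZT R\<^esub> y"
    using ex_minimal_neighbour assms(2) by auto
  have "x = y \<or> x \<rightarrow>\<^bsub>ZT R\<^esub> y"
    using minimal_elems_adjacent[OF x(1) y(1)] by blast
  moreover have "y = v \<or> y \<rightarrow>\<^bsub>ZT R\<^esub> v"
    using y(2) ZT_adjacent_sym by blast
  ultimately show ?thesis
    by (rule distance_le_of_steps[OF x(2) _ _ assms(2)])
qed

lemma le_distance_2:
  assumes "u \<noteq> v" "\<not> u \<rightarrow>\<^bsub>ZT R\<^esub> v"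
  shows "2 \<le> distance (ZT R) u v"
proof -
  have "(u, v) \<notin> arcs_ends (ZT R) ^^ k" if k: "k < 2" for k
  proof -
    consider "k = 0" | "k = 1"
      using k by linarith
    then show ?thesis
      using assms by cases auto
  qed
  then have "real 2 \<le> distance (ZT R) u v"
    by (rule ZT.le_distance)
  then show ?thesis
    by simp
qed

text \<open>
  If \<open>w\<close> were adjacent to \<open>e\<close> and to \<open>1 - e\<close>, then \<open>w = e w + (1 - e) w = 0\<close>.
\<close>

lemma idempotent_distance_3:
  assumes e: "e \<in> carrier R" "e \<otimes> e = e" "e \<noteq> \<zero>" "e \<noteq> \<one>"
  shows "e \<in> verts (ZT R)" "\<one> \<ominus> e \<in> verts (ZT R)" "3 \<le> distance (ZT R) e (\<one> \<ominus> e)"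
proof -
  let ?f = "\<one> \<ominus> e"
  have f: "?f \<in> carrier R" "?f \<noteq> \<zero>"
    using e by (auto simp: minus_eq_zero_iff)
  have "e \<otimes> ?f = e \<ominus> e \<otimes> e"
    using e(1) by algebra
  then have ef: "e \<otimes> ?f = \<zero>"
    using e(1) by (simp add: e(2) minus_eq_zero_iff)
  have sum: "e \<oplus> ?f = \<one>"
    using e(1) by algebra
  show "e \<in> verts (ZT R)" "?f \<in> verts (ZT R)"
    using e f ef by (auto intro: zero_divisorI simp: m_comm[of ?f e])
  have not_adj: "\<not> e \<rightarrow>\<^bsub>ZT R\<^esub> ?f"
    using sum one_not_zero_divisor one_neq_zero by (auto simp: ZT_adjacent_iff)
  have no_common: False if w: "e \<rightarrow>\<^bsub>ZT R\<^esub> w" "w \<rightarrow>\<^bsub>ZT R\<^esub> ?f" for w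
  proof -
    have "w \<in> carrier R" "w \<noteq> \<zero>" "e \<otimes> w = \<zero>" "w \<otimes> ?f = \<zero>"
      using w zero_divisors_subset by (auto simp: ZT_adjacent_iff)
    moreover from this have "w = e \<otimes> w \<oplus> w \<otimes> ?f"
      using e(1) by algebra
    ultimately show False by simp
  qed
  have "e \<noteq> ?f"
    using ef e by auto
  have "(e, ?f) \<notin> arcs_ends (ZT R) ^^ k" if k: "k < 3" for k
  proof -
    consider "k = 0" | "k = 1" | "k = 2"
      using k by linarith
    then show ?thesis
      using \<open>e \<noteq> ?f\<close> not_adj no_common by cases (auto simp: numeral_2_eq_2)
  qed
  then have "real 3 \<le> distance (ZT R) e ?f"
    by (rule ZT.le_distance)
  then show "3 \<le> distance (ZT R) e ?f"
    by simp
qed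

lemma diameter_non_local:
  assumes "\<not> local_cring R"
  shows "diameter (ZT R) = 3"
proof -
  obtain e where e: "e \<in> carrier R" "e \<otimes> e = e" "e \<noteq> \<zero>" "e \<noteq> \<one>"
    using ex_nontrivial_idempotent[OF assms one_neq_zero] .
  show ?thesis
    by (rule diameter_eqI[OF distance_le_3 idempotent_distance_3[OF e]])
qed

end

section \<open>The local case\<close>

locale connected_ZT_local = connected_ZT + local_cring +
  fixes M
  assumes maximalideal: "maximalideal M R"
begin

sublocale M: maximalideal M R
  by (rule maximalideal)

lemma minimal_elem_annihilator:
  assumes "minimal_elem x"
  shows "annihilator x = M"
proof -
  obtain N where N: "\<And>I. maximalideal I R \<Longrightarrow> I = N"
    using ex1_maximalideal by (elim ex1E) blast
  show ?thesis
    using N[OF annihilator_maximalideal[OF assms]] N[OF maximalideal] by simp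
qed

lemma ex_minimal_elem:
  obtains x where "minimal_elem x"
  using ex_minimal_elem_annihilated[of \<zero> \<one>] one_neq_zero by auto

text \<open>Both inclusions hold because \<open>M\<close> is the annihilator of every minimal element.\<close>

lemma zero_divisors_eq: "zero_divisors R = M"
proof
  show "zero_divisors R \<subseteq> M"
  proof
    fix u assume u: "u \<in> zero_divisors R"
    then have uc: "u \<in> carrier R"
      using zero_divisors_subset by auto
    obtain y where "y \<in> carrier R" "y \<noteq> \<zero>" "u \<otimes> y = \<zero>"
      using u one_neq_zero by (rule zero_divisorE)
    then obtain x where "minimal_elem x" "u \<otimes> x = \<zero>"
      using ex_minimal_elem_annihilated uc by blast
    then show "u \<in> M"
      using uc minimal_elem_annihilator by (auto simp: annihilator_def)
  qed
  obtain x where x: "minimal_elem x"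
    by (rule ex_minimal_elem)
  show "M \<subseteq> zero_divisors R"
    using minimal_elem_annihilator[OF x] minimal_elemD[OF x]
    by (auto simp: annihilator_def intro: zero_divisorI[of _ x])
qed

lemma adjacent_iff:
  "u \<rightarrow>\<^bsub>ZT R\<^esub> v \<longleftrightarrow> u \<in> M \<and> u \<noteq> \<zero> \<and> v \<in> M \<and> v \<noteq> \<zero> \<and> u \<noteq> v \<and> u \<otimes> v = \<zero>"
  using M.a_closed by (auto simp: ZT_adjacent_iff zero_divisors_eq)

lemma minimal_elem_mult:
  assumes "minimal_elem x" "u \<in> M"
  shows "u \<otimes> x = \<zero>" "x \<otimes> u = \<zero>"
  using minimal_elem_annihilator[OF assms(1)] assms(2) minimal_elemD(1)[OF assms(1)]
  by (auto simp: annihilator_def m_comm[of x u])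

lemma minimal_elem_mem:
  assumes "minimal_elem x"
  shows "x \<in> M"
  using minimal_elem_annihilator[OF assms] minimal_elem_square_zero[OF assms] minimal_elemD[OF assms]
  by (auto simp: annihilator_def)

lemma distance_le_2:
  assumes "u \<in> verts (ZT R)" "v \<in> verts (ZT R)"
  shows "distance (ZT R) u v \<le> 2"
proof -
  let ?E = "arcs_ends (ZT R)"
  obtain x where x: "minimal_elem x"
    by (rule ex_minimal_elem)
  have uv: "u \<in> M" "u \<noteq> \<zero>" "v \<in> M" "v \<noteq> \<zero>"
    using assms by (auto simp: zero_divisors_eq)
  have "\<exists>i\<le>1. (u, x) \<in> ?E ^^ i"
  proof (cases "u = x")
    case True
    then show ?thesis by (intro exI[of _ 0]) simp
  next
    case False
    then show ?thesis
      using uv x minimal_elem_mem minimal_elemD minimal_elem_mult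
      by (intro exI[of _ 1]) (simp add: adjacent_iff)
  qed
  moreover have "\<exists>i\<le>1. (x, v) \<in> ?E ^^ i"
  proof (cases "x = v")
    case True
    then show ?thesis by (intro exI[of _ 0]) simp
  next
    case False
    then show ?thesis
      using uv x minimal_elem_mem minimal_elemD minimal_elem_mult
      by (intro exI[of _ 1]) (simp add: adjacent_iff)
  qed
  ultimately obtain i j where ij: "i \<le> 1" "(u, x) \<in> ?E ^^ i" "j \<le> 1" "(x, v) \<in> ?E ^^ j"
    by blast
  then have "(u, v) \<in> ?E ^^ (i + j)"
    by (auto simp: relpow_add)
  then have "distance (ZT R) u v \<le> ereal (real (i + j))"
    using assms(2) by (rule ZT.distance_le)
  also have "\<dots> \<le> ereal 2"
    using ij by simp
  finally show ?thesis by simp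
qed

text \<open>
  If \<open>a \<noteq> b\<close>, then \<open>a\<close> and \<open>b\<close> are distinct vertices that are not adjacent. If \<open>a = b\<close>, then \<open>b\<close> is
  replaced by \<open>a + x\<close> with \<open>x\<close> minimal, which does not change the product because \<open>a x = 0\<close>.
\<close>

lemma diameter_2:
  assumes ab: "a \<in> M" "b \<in> M" "a \<otimes> b \<noteq> \<zero>"
  shows "diameter (ZT R) = 2"
proof -
  have c: "a \<in> carrier R" "b \<in> carrier R"
    using ab M.a_subset by auto
  have ab0: "a \<noteq> \<zero>" "b \<noteq> \<zero>"
    using ab c by auto
  obtain u v where uv: "u \<in> M" "v \<in> M" "u \<noteq> \<zero>" "v \<noteq> \<zero>" "u \<noteq> v" "u \<otimes> v \<noteq> \<zero>"
  proof (cases "a = b")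
    case False
    with ab ab0 show thesis
      using that by blast
  next
    case True
    obtain x where x: "minimal_elem x"
      by (rule ex_minimal_elem)
    note xc = minimal_elemD[OF x]
    have "a \<otimes> (a \<oplus> x) = a \<otimes> a \<oplus> a \<otimes> x"
      using c xc by (simp add: r_distr)
    then have "a \<otimes> (a \<oplus> x) \<noteq> \<zero>"
      using True ab c minimal_elem_mult(1)[OF x ab(1)] by simp
    moreover from this have "a \<oplus> x \<noteq> \<zero>"
      using c by auto
    moreover have "a \<noteq> a \<oplus> x"
      using c xc by simp
    moreover have "a \<oplus> x \<in> M"
      using ab(1) minimal_elem_mem[OF x] M.a_closed by blast
    ultimately show thesis
      using that ab(1) ab0(1) by blast
  qed
  then have "2 \<le> distance (ZT R) u v"
    by (intro le_distance_2) (auto simp: adjacent_iff)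
  moreover have "u \<in> verts (ZT R)" "v \<in> verts (ZT R)"
    using uv by (simp_all add: zero_divisors_eq)
  ultimately show ?thesis
    by (intro diameter_eqI[OF distance_le_2])
qed

lemma diameter_1:
  assumes zero: "\<And>a b. a \<in> M \<Longrightarrow> b \<in> M \<Longrightarrow> a \<otimes> b = \<zero>"
  shows "diameter (ZT R) = 1"
proof -
  have upper: "distance (ZT R) u v \<le> 1" if uv: "u \<in> verts (ZT R)" "v \<in> verts (ZT R)" for u v
  proof -
    consider "u = v" | "u \<rightarrow>\<^bsub>ZT R\<^esub> v"
      using uv zero by (auto simp: adjacent_iff zero_divisors_eq)
    then show ?thesis
    proof cases
      case 1
      then have "distance (ZT R) u v \<le> real 0"
        using uv(2) by (intro ZT.distance_le) auto
      also have "\<dots> \<le> 1"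
        by simp
      finally show ?thesis .
    next
      case 2
      then have "distance (ZT R) u v \<le> real 1"
        using uv(2) by (intro ZT.distance_le) auto
      then show ?thesis
        by (simp add: one_ereal_def)
    qed
  qed
  obtain b c where bc: "b \<rightarrow>\<^bsub>ZT R\<^esub> c"
    by (rule ex_edge)
  then have bc': "b \<in> verts (ZT R)" "c \<in> verts (ZT R)" "b \<noteq> c"
    by (auto simp: ZT_adjacent_iff)
  have "real 1 \<le> distance (ZT R) b c"
    using bc'(3) by (intro ZT.le_distance) simp
  then have "1 \<le> distance (ZT R) b c"
    by (simp add: one_ereal_def)
  with upper bc'(1,2) show ?thesis
    by (rule diameter_eqI)
qed

lemma ex_nonzero_product_of_nilindex:
  assumes "has_nilindex R M n" "3 \<le> n"
  obtains a b where "a \<in> M" "b \<in> M" "a \<otimes> b \<noteq> \<zero>"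
proof -
  have "\<not> products_vanish R M 2"
    using assms by (auto simp: has_nilindex_def)
  then obtain x where x: "x \<in> {..<2::nat} \<rightarrow> M" "finprod R x {..<2} \<noteq> \<zero>"
    by (auto simp: products_vanish_def)
  then have xM: "x 0 \<in> M" "x 1 \<in> M"
    by auto
  have "{..<2} = {0, 1::nat}"
    by auto
  then have "finprod R x {..<2} = x 0 \<otimes> x 1"
    using xM M.a_subset by (auto simp: subset_iff Pi_iff)
  with x(2) xM show thesis
    using that by auto
qed

end

section \<open>The diameter\<close>

theorem theorem3p2:
  fixes R :: "('a, 'b) ring_scheme"
  assumes "artinian_cring R"
    and "Digraph_Component.connected (ZT R)"
    and "arcs (ZT R) \<noteq> {}"
  shows "(\<not> local_cring R \<longrightarrow> diameter (ZT R) = 3) \<and>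
    (\<forall>M n. local_cring R \<and> maximalideal M R \<and> has_nilindex R M n \<and> n \<ge> 3
      \<longrightarrow> diameter (ZT R) = 2) \<and>
    (\<forall>M. local_cring R \<and> maximalideal M R \<and> ideal_prod R M M = {\<zero>\<^bsub>R\<^esub>} \<and> M \<noteq> {\<zero>\<^bsub>R\<^esub>}
      \<longrightarrow> diameter (ZT R) = 1)"
proof -
  have ZT: "connected_ZT R"
    using assms by (simp add: connected_ZT_def connected_ZT_axioms_def)
  have local: "connected_ZT_local R M" if "local_cring R" "maximalideal M R" for M
    using ZT that by (simp add: connected_ZT_local_def connected_ZT_local_axioms_def)
  show ?thesis
  proof (intro conjI allI impI)
    assume "\<not> local_cring R"
    then show "diameter (ZT R) = 3"
      by (rule connected_ZT.diameter_non_local[OF ZT])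
  next
    fix M n
    assume *: "local_cring R \<and> maximalideal M R \<and> has_nilindex R M n \<and> n \<ge> 3"
    then interpret connected_ZT_local R M
      using local by blast
    show "diameter (ZT R) = 2"
      using * ex_nonzero_product_of_nilindex[of n] diameter_2 by blast
  next
    fix M
    assume *: "local_cring R \<and> maximalideal M R \<and> ideal_prod R M M = {\<zero>\<^bsub>R\<^esub>} \<and> M \<noteq> {\<zero>\<^bsub>R\<^esub>}"
    then interpret connected_ZT_local R M
      using local by blast
    show "diameter (ZT R) = 1"
      using * ideal_prod.prod[of _ M _ M R] by (intro diameter_1) auto
  qed
qed

end
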